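(* Let $s=A^T\lambda^{(s)}$ with $\lambda^{(s)}\in\Delta^m$ and $\hat g(c(s))\le1+\delta$ for some $\delta>0$, let $q=A^T\lambda^{(q)}$ with $\lambda^{(q)}\in\Delta^m$, and let $\omega\in(1,2]$. Let $U:=c(s)\,(1+\omega\delta n+\sqrt{\omega\delta n})/(1+\delta)$ and $I:=\{i\in[m]:\langle A_i,U\rangle\ge1\}$. Let $$\sigma:=\min\left(\sqrt{\omega\delta n}+\omega\delta n,\ \frac{1+\omega\delta}{1+\delta}\max_{i\in[n]}\frac1{s_i}-1\right),\qquad \tau:=\min(3\sqrt{\omega\delta n},1).$$ Then the oracle described in the context returns a pair $\lambda^{(o)}\in\Delta^m$, $o\in c(\mathcal{D})$ with $o=c(A^T\lambda^{(o)})$ such that: 1. $\langle q,o\rangle\le1$. 2. If $i\in I$, then $\langle A_i,o\rangle\in[1-\tau,1+\sigma]$. 3. If $i\in[m]\setminus I$, then $\langle A_i,o\rangle\le1$. Moreover, the oracle runs in time $O\left(n\log\left(\frac{n}{(\omega-1)\delta}+\frac{n}{\omega-1}\right)\right)$.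
   Context: $\Delta^m=\{\lambda\in\mathbb{R}^m_{\ge0}:\sum_i\lambda_i=1\}$. $A\in\mathbb{R}^{m\times n}$ has non-negative entries, $\max_iA_{ij}=1$ for each column $j$, and its first $n$ rows are the canonical basis vectors $e_1,\dots,e_n$; $A_i$ is the $i$-th row. The centroid map on vectors with strictly positive coordinates is $c(h):=(\frac1{nh_1},\dots,\frac1{nh_n})$; for a set $S$, $c(S)=\{c(h):h\in S,\ h>0\}$. $\mathcal{D}:=\{A^T\lambda:\lambda\in\Delta^m\}$. $\hat g(p):=\max_{i\in[m]}\langle A_i,p\rangle$ (the hypothesis $\hat g(c(s))\le 1+\delta$ includes $s>0$). Oracle (input $s,\lambda^{(s)},q,\lambda^{(q)},\delta,\omega$): (a) if $\langle s,c(q)\rangle\le\frac{1+\omega\delta}{1+\delta}$ (understood as false if $q$ has a zero coordinate), return $\lambda^{(o)}=\lambda^{(q)}$, $o=c(q)$; (b) else if $\langle q,c(s)\rangle\le1$, return $\lambda^{(o)}=\lambda^{(s)}$, $o=c(s)$; (c) else find by the bisection method on $(0,1)$ a $\mu\in(0,1)$ with $\langle s,c((1-\mu)s+\mu q)\rangle\in\left(1,\frac{1+\omega\delta}{1+\delta}\right)$ and return $\lambda^{(o)}=(1-\mu)\lambda^{(s)}+\mu\lambda^{(q)}$, $o=c((1-\mu)s+\mu q)$. The running time is the number of arithmetic operations when the vectors $s$ and $q$ are given, not counting the trivial formation of $\lambda^{(o)}$ from $\mu,\lambda^{(s)},\lambda^{(q)}$.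
   Formalization: The running time is bounded by O(n·max(1, log₂(n/((ω−1)δ)+n/(ω−1)))); the maximum matters only for n=1, where for ω=2 and δ→∞ the logarithm tends to 0 while the oracle still makes at least one operation, so the literal bound fails. *)

theory Defs
  imports "Jordan_Normal_Form.Matrix" "HOL-Library.Monad_Syntax"
begin

text \<open>Indices are 0-based: an index in \<open>[m]\<close> is an \<open>i < m\<close>.\<close>

definition simplex :: "nat \<Rightarrow> real vec set" where
  "simplex m = {l \<in> carrier_vec m. (\<forall>i<m. 0 \<le> l $ i) \<and> (\<Sum>i<m. l $ i) = 1}"

definition packing_matrix :: "nat \<Rightarrow> nat \<Rightarrow> real mat \<Rightarrow> bool" where
  "packing_matrix m n A \<longleftrightarrow>
     A \<in> carrier_mat m n \<and> 0 < n \<and> n \<le> m \<and>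
     (\<forall>i<m. \<forall>j<n. 0 \<le> A $$ (i, j)) \<and>
     (\<forall>j<n. Max ((\<lambda>i. A $$ (i, j)) ` {..<m}) = 1) \<and>
     (\<forall>i<n. row A i = unit_vec n i)"

definition pos_vec :: "real vec \<Rightarrow> bool" where
  "pos_vec h \<longleftrightarrow> (\<forall>i<dim_vec h. 0 < h $ i)"

text \<open>The centroid map is only meaningful on vectors satisfying \<^const>\<open>pos_vec\<close>;
  elsewhere its value is an artefact of \<open>1 / 0 = 0\<close>.\<close>

definition centroid :: "real vec \<Rightarrow> real vec" where
  "centroid h = vec (dim_vec h) (\<lambda>i. 1 / (real (dim_vec h) * h $ i))"

definition centroid_set :: "real vec set \<Rightarrow> real vec set" where
  "centroid_set S = {centroid h | h. h \<in> S \<and> pos_vec h}"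

definition row_hull :: "real mat \<Rightarrow> real vec set" where
  "row_hull A = {A\<^sup>T *\<^sub>v l | l. l \<in> simplex (dim_row A)}"

definition g_hat :: "real mat \<Rightarrow> real vec \<Rightarrow> real" where
  "g_hat A p = Max ((\<lambda>i. row A i \<bullet> p) ` {..<dim_row A})"


text \<open>
  Computations with an operation count. \<open>Some (x, t)\<close> is a computation that terminates with
  result \<open>x\<close> after \<open>t\<close> operations on real numbers, \<open>None\<close> one that does not terminate.
  Each addition, subtraction, multiplication, division and comparison of two reals costs one
  unit; reading coordinates, assembling a vector from its coordinates and control flow are free.
\<close>

type_synonym 'a counted = "('a \<times> nat) option"

definition ret :: "'a \<Rightarrow> 'a counted" where
  "ret x = Some (x, 0)"

definition cbind :: "'a counted \<Rightarrow> ('a \<Rightarrow> 'b counted) \<Rightarrow> 'b counted" where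
  "cbind p f = Option.bind p (\<lambda>x. Option.bind (f (fst x)) (\<lambda>y. Some (fst y, snd x + snd y)))"

adhoc_overloading Monad_Syntax.bind \<rightleftharpoons> cbind

lemma cbind_mono [partial_function_mono]:
  assumes "mono_option B" and "\<And>y. mono_option (\<lambda>f. C y f)"
  shows "mono_option (\<lambda>f. cbind (B f) (\<lambda>y. C y f))"
  unfolding cbind_def
  by (intro bind_mono assms option.const_mono)

definition add_c :: "real \<Rightarrow> real \<Rightarrow> real counted" where "add_c x y = Some (x + y, 1)"
definition sub_c :: "real \<Rightarrow> real \<Rightarrow> real counted" where "sub_c x y = Some (x - y, 1)"
definition mul_c :: "real \<Rightarrow> real \<Rightarrow> real counted" where "mul_c x y = Some (x * y, 1)"
definition div_c :: "real \<Rightarrow> real \<Rightarrow> real counted" where "div_c x y = Some (x / y, 1)"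
definition le_c :: "real \<Rightarrow> real \<Rightarrow> bool counted" where "le_c x y = Some (x \<le> y, 1)"
definition eq_c :: "real \<Rightarrow> real \<Rightarrow> bool counted" where "eq_c x y = Some (x = y, 1)"

fun tabulate_c :: "nat \<Rightarrow> (nat \<Rightarrow> real counted) \<Rightarrow> real list counted" where
  "tabulate_c 0 f = ret []"
| "tabulate_c (Suc k) f = do { xs \<leftarrow> tabulate_c k f; x \<leftarrow> f k; ret (xs @ [x]) }"

definition vec_c :: "nat \<Rightarrow> (nat \<Rightarrow> real counted) \<Rightarrow> real vec counted" where
  "vec_c n f = do { xs \<leftarrow> tabulate_c n f; ret (vec_of_list xs) }"

fun dot_upto_c :: "nat \<Rightarrow> real vec \<Rightarrow> real vec \<Rightarrow> real counted" where
  "dot_upto_c 0 x y = ret 0"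
| "dot_upto_c (Suc k) x y =
     do { a \<leftarrow> dot_upto_c k x y; p \<leftarrow> mul_c (x $ k) (y $ k); add_c a p }"

definition dot_c :: "real vec \<Rightarrow> real vec \<Rightarrow> real counted" where
  "dot_c x y = dot_upto_c (dim_vec y) x y"

definition centroid_c :: "real vec \<Rightarrow> real vec counted" where
  "centroid_c h =
     vec_c (dim_vec h) (\<lambda>i. do { p \<leftarrow> mul_c (real (dim_vec h)) (h $ i); div_c 1 p })"

definition mix_c :: "real \<Rightarrow> real vec \<Rightarrow> real vec \<Rightarrow> real vec counted" where
  "mix_c \<mu> s q = do {
     \<nu> \<leftarrow> sub_c 1 \<mu>;
     vec_c (dim_vec s) (\<lambda>i. do { a \<leftarrow> mul_c \<nu> (s $ i); b \<leftarrow> mul_c \<mu> (q $ i); add_c a b }) }"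

fun zero_upto_c :: "nat \<Rightarrow> real vec \<Rightarrow> bool counted" where
  "zero_upto_c 0 x = ret False"
| "zero_upto_c (Suc k) x =
     do { b \<leftarrow> zero_upto_c k x; if b then ret True else eq_c (x $ k) 0 }"

definition has_zero_c :: "real vec \<Rightarrow> bool counted" where
  "has_zero_c x = zero_upto_c (dim_vec x) x"

text \<open>The counted vector operations compute their uncounted counterparts.\<close>

lemma cbind_Some [simp]:
  "cbind (Some (x, t)) f = (case f x of None \<Rightarrow> None | Some (y, u) \<Rightarrow> Some (y, t + u))"
  by (cases "f x") (auto simp: cbind_def)

lemmas primitive_c_defs = ret_def add_c_def sub_c_def mul_c_def div_c_def le_c_def eq_c_def

lemma tabulate_c_eq:
  assumes "\<And>i. i < n \<Longrightarrow> f i = Some (g i, k)"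
  shows "tabulate_c n f = Some (map g [0..<n], n * k)"
  using assms by (induction n) (auto simp: ret_def)

lemma vec_c_eq:
  assumes "\<And>i. i < n \<Longrightarrow> f i = Some (g i, k)"
  shows "vec_c n f = Some (vec n g, n * k)"
proof -
  have "vec_of_list (map g [0..<n]) = vec n g"
    by (intro eq_vecI) (auto simp: vec_of_list_index)
  then show ?thesis
    by (simp add: vec_c_def tabulate_c_eq[OF assms] ret_def)
qed

lemma dot_c_eq: "dot_c x y = Some (x \<bullet> y, 2 * dim_vec y)"
proof -
  have "dot_upto_c n x y = Some (\<Sum>i<n. x $ i * y $ i, 2 * n)" for n
    by (induction n) (auto simp: primitive_c_defs)
  then show ?thesis
    by (simp add: dot_c_def scalar_prod_def lessThan_atLeast0)
qed

lemma centroid_c_eq: "centroid_c h = Some (centroid h, 2 * dim_vec h)"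
  unfolding centroid_c_def centroid_def
  by (subst vec_c_eq) (auto simp: primitive_c_defs)

lemma mix_c_eq:
  assumes "dim_vec q = dim_vec s"
  shows "mix_c \<mu> s q = Some ((1 - \<mu>) \<cdot>\<^sub>v s + \<mu> \<cdot>\<^sub>v q, 1 + 3 * dim_vec s)"
proof -
  have "vec (dim_vec s) (\<lambda>i. (1 - \<mu>) * s $ i + \<mu> * q $ i) = (1 - \<mu>) \<cdot>\<^sub>v s + \<mu> \<cdot>\<^sub>v q"
    using assms by (intro eq_vecI) auto
  moreover have "vec_c (dim_vec s)
      (\<lambda>i. cbind (mul_c (1 - \<mu>) (s $ i)) (\<lambda>a. cbind (mul_c \<mu> (q $ i)) (add_c a)))
    = Some (vec (dim_vec s) (\<lambda>i. (1 - \<mu>) * s $ i + \<mu> * q $ i), dim_vec s * 3)"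
    by (rule vec_c_eq) (simp add: primitive_c_defs)
  ultimately show ?thesis
    by (simp add: mix_c_def sub_c_def)
qed

lemma has_zero_c_eq:
  "\<exists>t \<le> dim_vec x. has_zero_c x = Some (\<exists>i<dim_vec x. x $ i = 0, t)"
proof -
  have "\<exists>t \<le> n. zero_upto_c n x = Some (\<exists>i<n. x $ i = 0, t)" for n
  proof (induction n)
    case 0
    then show ?case by (simp add: ret_def)
  next
    case (Suc n)
    then obtain t where "t \<le> n" "zero_upto_c n x = Some (\<exists>i<n. x $ i = 0, t)" by blast
    then show ?case
      by (cases "\<exists>i<n. x $ i = 0") (auto simp: primitive_c_defs less_Suc_eq)
  qed
  then show ?thesis
    by (simp add: has_zero_c_def)
qed

text \<open>
  With \<open>f \<mu> = \<langle>s, c ((1 - \<mu>) s + \<mu> q)\<rangle>\<close>, bisection looks for \<open>\<mu>\<close> with \<open>1 < f \<mu> < T\<close> between a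
  left end where \<open>f \<le> 1\<close> and a right end where \<open>f \<ge> T\<close>. It returns \<open>\<mu>\<close> and
  \<open>c ((1 - \<mu>) s + \<mu> q)\<close>.
\<close>

partial_function (option) bisect_c ::
  "real vec \<Rightarrow> real vec \<Rightarrow> real \<Rightarrow> real \<Rightarrow> real \<Rightarrow> (real \<times> real vec) counted" where
  "bisect_c s q T lo hi = do {
     d \<leftarrow> add_c lo hi;
     \<mu> \<leftarrow> div_c d 2;
     h \<leftarrow> mix_c \<mu> s q;
     p \<leftarrow> centroid_c h;
     v \<leftarrow> dot_c s p;
     small \<leftarrow> le_c v 1;
     if small then bisect_c s q T \<mu> hi
     else do {
       large \<leftarrow> le_c T v;
       if large then bisect_c s q T lo \<mu> else ret (\<mu>, p) } }"

text \<open>The returned combination of \<open>ls\<close> and \<open>lq\<close> is formed with the uncounted vector operations: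
  its cost is by convention not part of the running time.\<close>

definition centroid_oracle ::
  "real vec \<Rightarrow> real vec \<Rightarrow> real vec \<Rightarrow> real vec \<Rightarrow> real \<Rightarrow> real \<Rightarrow> (real vec \<times> real vec) counted"
where
  "centroid_oracle s ls q lq \<delta> \<omega> = do {
     od \<leftarrow> mul_c \<omega> \<delta>;
     num \<leftarrow> add_c 1 od;
     den \<leftarrow> add_c 1 \<delta>;
     T \<leftarrow> div_c num den;
     cq \<leftarrow> do {
       z \<leftarrow> has_zero_c q;
       if z then ret None
       else do {
         p \<leftarrow> centroid_c q;
         v \<leftarrow> dot_c s p;
         b \<leftarrow> le_c v T;
         ret (if b then Some p else None) } };
     case cq of
       Some p \<Rightarrow> ret (lq, p)
     | None \<Rightarrow> do {
         p \<leftarrow> centroid_c s;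
         v \<leftarrow> dot_c q p;
         b \<leftarrow> le_c v 1;
         if b then ret (ls, p)
         else do {
           (\<mu>, p) \<leftarrow> bisect_c s q T 0 1;
           ret ((1 - \<mu>) \<cdot>\<^sub>v ls + \<mu> \<cdot>\<^sub>v lq, p) } } }"

end

theory Submission
  imports Defs
begin

text \<open>
  Let \<open>h\<close> be the point whose centroid is returned and put \<open>w\<^sub>j = h\<^sub>j / ((1 + \<delta>) s\<^sub>j)\<close>. The bound on
  \<open>g_hat\<close> says that the mean of the \<open>w\<^sub>j\<close> is at most \<open>1\<close>, and \<open>\<langle>s, c h\<rangle> \<le> (1 + \<omega> \<delta>) / (1 + \<delta>)\<close> says
  that the mean of the \<open>1 / w\<^sub>j\<close> is at most \<open>1 + \<omega> \<delta>\<close>. Since every \<open>w\<^sub>j + 1 / w\<^sub>j - 2\<close> is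
  nonnegative, each is at most \<open>\<omega> \<delta> n\<close>, so \<open>w\<^sub>j\<close> and \<open>1 / w\<^sub>j\<close> are at most
  \<open>\<kappa> = 1 + sqrt (\<omega> \<delta> n) + \<omega> \<delta> n\<close>. Thus \<open>c h\<close> lies coordinatewise between
  \<open>U / \<kappa>\<^sup>2\<close> and \<open>U\<close>.

  With \<open>f \<mu> = \<langle>s, c ((1 - \<mu>) s + \<mu> q)\<rangle>\<close>, the bound \<open>f lo \<le> 1\<close> keeps every coordinate ratio at \<open>lo\<close>
  above \<open>1 / n\<close>, so \<open>f\<close> grows at rate \<open>O(n)\<close> just to the right of \<open>lo\<close> and has no pole there.
  Hence an interval with \<open>f lo \<le> 1\<close> and \<open>f hi \<ge> T\<close> is never shorter than \<open>(T - 1) / (4 n)\<close>, which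
  bounds the number of bisection steps without appealing to convexity of \<open>f\<close>.
\<close>

section \<open>Elementary inequalities for \<open>z + 1 / z\<close> and for sums of
  reciprocals\<close>

text \<open>With \<open>u = z - 1\<close> the hypothesis becomes
  \<open>u * (u - v^2) \<le> v^2\<close>, whereas \<open>u > v + v^2\<close> would push the left
  side above \<open>(v + v^2) * v\<close>, which is at least \<open>v^2\<close>.\<close>

lemma le_of_add_inverse_le:
  fixes z v :: real
  assumes "0 < z" "0 \<le> v" "z + 1 / z \<le> 2 + v\<^sup>2"
  shows "z \<le> 1 + v + v\<^sup>2"
proof (rule ccontr)
  assume "\<not> z \<le> 1 + v + v\<^sup>2"
  then have t: "v + v\<^sup>2 < z - 1" by simp
  have "(z + 1 / z) * z \<le> (2 + v\<^sup>2) * z"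
    using assms by (intro mult_right_mono) auto
  then have "z * z + 1 \<le> (2 + v\<^sup>2) * z"
    using assms(1) by (simp add: distrib_right)
  then have "(z - 1) * (z - 1 - v\<^sup>2) \<le> v\<^sup>2"
    by (simp add: algebra_simps)
  moreover have "(v + v\<^sup>2) * v < (z - 1) * (z - 1 - v\<^sup>2)"
    using t assms(2) by (intro mult_strict_mono') auto
  moreover have "v\<^sup>2 \<le> (v + v\<^sup>2) * v"
    using assms(2) by (simp add: power2_eq_square algebra_simps)
  ultimately show False by linarith
qed

lemma means_near_one_imp_coordinates_near_one:
  fixes w :: "nat \<Rightarrow> real"
  assumes pos: "\<And>i. i < n \<Longrightarrow> 0 < w i"
    and sum: "(\<Sum>i<n. w i) \<le> real n" and inv: "(\<Sum>i<n. 1 / w i) \<le> real n * (1 + e)"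
    and "0 \<le> e" and j: "j < n"
  defines "\<kappa> \<equiv> 1 + sqrt (e * real n) + e * real n"
  shows "w j \<le> \<kappa>" "1 / w j \<le> \<kappa>"
proof -
  have nonneg: "0 \<le> w i + 1 / w i - 2" if "i < n" for i
  proof -
    have "w i + 1 / w i - 2 = (w i - 1)\<^sup>2 / w i"
      using pos[OF that] by (simp add: field_simps power2_eq_square)
    then show ?thesis using pos[OF that] by simp
  qed
  have "w j + 1 / w j - 2 \<le> (\<Sum>i<n. w i + 1 / w i - 2)"
    using j nonneg by (intro member_le_sum) auto
  also have "\<dots> = (\<Sum>i<n. w i) + (\<Sum>i<n. 1 / w i) - 2 * real n"
    by (simp add: sum.distrib sum_subtractf)
  also have "\<dots> \<le> e * real n"
    using sum inv by (simp add: algebra_simps)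
  finally have *: "w j + 1 / w j \<le> 2 + (sqrt (e * real n))\<^sup>2"
    using \<open>0 \<le> e\<close> by simp
  show "w j \<le> \<kappa>"
    using le_of_add_inverse_le[OF pos[OF j] _ *] \<open>0 \<le> e\<close> by (simp add: \<kappa>_def)
  \<comment> \<open>The estimate \<open>*\<close> is invariant under replacing \<open>w j\<close> by
    its inverse.\<close>
  show "1 / w j \<le> \<kappa>"
    using le_of_add_inverse_le[of "1 / w j" "sqrt (e * real n)"] * pos[OF j] \<open>0 \<le> e\<close>
    by (simp add: \<kappa>_def add.commute)
qed

text \<open>The bound on the sum forces \<open>x i \<ge> 1 / n\<close>, so an absolute loss
  \<open>d\<close> is a relative loss of at most \<open>p = n * d\<close>. Since
  \<open>4 * p < e \<le> 1\<close>, each reciprocal grows by a factor of at most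
  \<open>1 / (1 - p) \<le> 1 + 2 * p\<close>, which is below \<open>1 + e\<close>.\<close>

lemma sum_inverse_perturbation:
  fixes x z :: "nat \<Rightarrow> real"
  assumes pos: "\<And>i. i < n \<Longrightarrow> 0 < x i" and sum: "(\<Sum>i<n. 1 / x i) \<le> real n"
    and z: "\<And>i. i < n \<Longrightarrow> x i - d \<le> z i"
    and d: "0 \<le> d" "4 * real n * d < e" and "e \<le> 1" and "0 < n"
  shows "\<forall>i<n. 0 < z i" "(\<Sum>i<n. 1 / z i) < real n * (1 + e)"
proof -
  have nd: "real n * d \<le> 1 / 4" using d \<open>e \<le> 1\<close> by linarith
  have *: "0 < z i \<and> 1 / z i \<le> (1 + 2 * real n * d) * (1 / x i)" if i: "i < n" for i
  proof -
    have "1 / x i \<le> (\<Sum>i<n. 1 / x i)"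
      using i pos by (intro member_le_sum) (auto simp: less_imp_le)
    then have "1 / x i \<le> real n" using sum by linarith
    then have nx: "1 \<le> real n * x i" using pos[OF i] by (simp add: field_simps)
    have dx: "d \<le> real n * d * x i"
      using mult_left_mono[OF nx d(1)] by (simp add: algebra_simps)
    have "real n * d * x i \<le> 1 / 4 * x i"
      using nd pos[OF i] by (intro mult_right_mono) auto
    then have "0 < x i - d" using dx pos[OF i] by linarith
    then have z_pos: "0 < z i" using z[OF i] by linarith
    define p where "p = real n * d"
    have p: "0 \<le> p" "p \<le> 1 / 4" using d nd by (auto simp: p_def)
    \<comment> \<open>Expanding leaves \<open>p * (1 - 2 * p) \<ge> 0\<close>.\<close>
    have "1 \<le> (1 + 2 * p) * (1 - p)"
      using mult_left_mono[OF p(2) p(1)] p by (simp add: algebra_simps)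
    then have "x i \<le> (1 + 2 * p) * (1 - p) * x i"
      using pos[OF i] by simp
    also have "\<dots> = (1 + 2 * p) * (x i - p * x i)" by (simp add: algebra_simps)
    also have "\<dots> \<le> (1 + 2 * p) * z i"
      using z[OF i] dx[folded p_def] p by (intro mult_left_mono) linarith+
    finally have "1 / z i \<le> (1 + 2 * p) / x i"
      using z_pos pos[OF i] by (simp add: field_simps)
    then show ?thesis using z_pos by (simp add: p_def mult.assoc)
  qed
  then show "\<forall>i<n. 0 < z i" by blast
  have "(\<Sum>i<n. 1 / z i) \<le> (\<Sum>i<n. (1 + 2 * real n * d) * (1 / x i))"
    using * by (intro sum_mono) auto
  also have "\<dots> = (1 + 2 * real n * d) * (\<Sum>i<n. 1 / x i)"
    by (rule sum_distrib_left[symmetric])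
  also have "\<dots> \<le> (1 + 2 * real n * d) * real n"
    using sum d by (intro mult_left_mono) auto
  also have "\<dots> < (1 + e) * real n"
  proof (rule mult_strict_right_mono)
    have "2 * real n * d \<le> 4 * real n * d" using d(1) by simp
    then show "1 + 2 * real n * d < 1 + e" using d by linarith
  qed (use \<open>0 < n\<close> in simp)
  finally show "(\<Sum>i<n. 1 / z i) < real n * (1 + e)" by (simp add: mult.commute)
qed

section \<open>The centroid map and the row hull\<close>

lemma dim_centroid [simp]: "dim_vec (centroid h) = dim_vec h"
  by (simp add: centroid_def)

lemma centroid_index: "i < dim_vec h \<Longrightarrow> centroid h $ i = 1 / (real (dim_vec h) * h $ i)"
  by (simp add: centroid_def)

lemma scalar_prod_centroid:
  "x \<bullet> centroid h = (\<Sum>i<dim_vec h. x $ i / h $ i) / real (dim_vec h)"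
  by (simp add: scalar_prod_def centroid_index sum_divide_distrib lessThan_atLeast0 mult.commute)

lemma scalar_prod_centroid_self:
  assumes "pos_vec h" "0 < dim_vec h"
  shows "h \<bullet> centroid h = 1"
proof -
  have "(\<Sum>i<dim_vec h. h $ i / h $ i) = (\<Sum>i<dim_vec h. 1)"
    using assms(1) by (intro sum.cong refl) (force simp: pos_vec_def)
  then show ?thesis using assms(2) unfolding scalar_prod_centroid by auto
qed

lemma scalar_prod_mono:
  fixes a x y :: "real vec"
  assumes "dim_vec x = dim_vec y" "\<And>j. j < dim_vec y \<Longrightarrow> 0 \<le> a $ j"
    and "\<And>j. j < dim_vec y \<Longrightarrow> x $ j \<le> y $ j"
  shows "a \<bullet> x \<le> a \<bullet> y"
  unfolding scalar_prod_def using assms by (auto intro!: sum_mono mult_left_mono)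

lemma packing_entry_le_1:
  assumes "packing_matrix m n A" "i < m" "j < n"
  shows "A $$ (i, j) \<le> 1"
proof -
  have "A $$ (i, j) \<le> Max ((\<lambda>i. A $$ (i, j)) ` {..<m})"
    using assms(2) by (intro Max_ge) auto
  also have "\<dots> = 1" using assms by (simp add: packing_matrix_def)
  finally show ?thesis .
qed

lemma row_hull_nonneg:
  assumes "packing_matrix m n A" "l \<in> simplex m" "j < n"
  shows "0 \<le> (A\<^sup>T *\<^sub>v l) $ j"
  using assms
  by (auto simp: packing_matrix_def simplex_def scalar_prod_def intro!: sum_nonneg)

text \<open>Moving the transpose across the scalar product leaves a convex combination of row
  values. This carries the bound on the maximum in \<open>g_hat\<close> over to the whole row
  hull.\<close>

lemma row_hull_scalar_prod_le:
  assumes A: "A \<in> carrier_mat m n" and l: "l \<in> simplex m" and p: "p \<in> carrier_vec n"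
    and le: "\<And>i. i < m \<Longrightarrow> row A i \<bullet> p \<le> b"
  shows "(A\<^sup>T *\<^sub>v l) \<bullet> p \<le> b"
proof -
  have "(A\<^sup>T *\<^sub>v l) \<bullet> p = l \<bullet> (A *\<^sub>v p)"
    using A l p by (intro transpose_vec_mult_scalar) (auto simp: simplex_def)
  also have "\<dots> = (\<Sum>i<m. l $ i * (row A i \<bullet> p))"
    using A by (simp add: scalar_prod_def[of l] lessThan_atLeast0)
  also have "\<dots> \<le> (\<Sum>i<m. l $ i * b)"
    using l le by (intro sum_mono mult_left_mono) (auto simp: simplex_def)
  also have "\<dots> = b"
    using l by (simp add: simplex_def flip: sum_distrib_right)
  finally show ?thesis .
qed

lemma simplex_convex:
  assumes "x \<in> simplex m" "y \<in> simplex m" "0 \<le> \<mu>" "\<mu> \<le> 1"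
  shows "(1 - \<mu>) \<cdot>\<^sub>v x + \<mu> \<cdot>\<^sub>v y \<in> simplex m"
proof -
  have "(\<Sum>i<m. (1 - \<mu>) * x $ i + \<mu> * y $ i) = (1 - \<mu>) * (\<Sum>i<m. x $ i) + \<mu> * (\<Sum>i<m. y $ i)"
    by (simp add: sum.distrib sum_distrib_left)
  then show ?thesis
    using assms by (auto simp: simplex_def)
qed

section \<open>Comparing the returned centroid with that of \<open>s\<close>\<close>

text \<open>The first two bounds are the coordinatewise comparison by \<open>\<kappa>\<close>, which
  survives pairing with a nonnegative row. The third bypasses \<open>\<kappa>\<close>: entries are
  at most \<open>1\<close>, so each row lies below \<open>Max (...) * s\<close>, and
  \<open>sh\<close> controls the product with \<open>s\<close>.\<close>

lemma centroid_bounds: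
  assumes A: "packing_matrix m n A"
    and s: "s \<in> carrier_vec n" "pos_vec s" and g: "\<forall>i<m. row A i \<bullet> centroid s \<le> 1 + \<delta>"
    and l: "l \<in> simplex m" and h: "h = A\<^sup>T *\<^sub>v l" "pos_vec h"
    and \<delta>: "0 < \<delta>" and \<omega>: "1 < \<omega>"
    and sh: "s \<bullet> centroid h \<le> (1 + \<omega> * \<delta>) / (1 + \<delta>)"
  defines "\<kappa> \<equiv> 1 + sqrt (\<omega> * \<delta> * real n) + \<omega> * \<delta> * real n"
  assumes i: "i < m"
  shows "row A i \<bullet> centroid h \<le> \<kappa> / (1 + \<delta>) * (row A i \<bullet> centroid s)"
    and "row A i \<bullet> centroid s \<le> \<kappa> * (1 + \<delta>) * (row A i \<bullet> centroid h)"
    and "row A i \<bullet> centroid h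
      \<le> (1 + \<omega> * \<delta>) / (1 + \<delta>) * Max ((\<lambda>i. 1 / s $ i) ` {..<n})"
proof -
  have Ac: "A \<in> carrier_mat m n" and n: "0 < n"
    and A0: "\<And>j. j < n \<Longrightarrow> 0 \<le> row A i $ j"
    using A i by (auto simp: packing_matrix_def)
  have dim: "dim_vec s = n" "dim_vec h = n" using s h Ac by auto
  have s0: "0 < s $ j" and h0: "0 < h $ j" if "j < n" for j
    using that s h dim by (auto simp: pos_vec_def)
  define w where "w j = h $ j / ((1 + \<delta>) * s $ j)" for j
  have w0: "0 < w j" if "j < n" for j
    using s0[OF that] h0[OF that] \<delta> by (simp add: w_def)
  have "h \<bullet> centroid s \<le> 1 + \<delta>"
    unfolding h(1) using Ac l dim g
    by (intro row_hull_scalar_prod_le) (auto intro: carrier_vecI)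
  then have "(\<Sum>j<n. h $ j / s $ j) \<le> (1 + \<delta>) * real n"
    using n by (simp add: scalar_prod_centroid dim field_simps)
  moreover have "(\<Sum>j<n. w j) = (\<Sum>j<n. h $ j / s $ j) / (1 + \<delta>)"
    unfolding sum_divide_distrib by (simp add: w_def mult.commute)
  ultimately have sum: "(\<Sum>j<n. w j) \<le> real n"
    using \<delta> by (simp add: divide_le_eq mult.commute)
  have "(\<Sum>j<n. s $ j / h $ j) * (1 + \<delta>) \<le> real n * (1 + \<omega> * \<delta>)"
    using sh n \<delta> by (simp add: scalar_prod_centroid dim field_simps)
  moreover have "(\<Sum>j<n. 1 / w j) = (\<Sum>j<n. s $ j / h $ j) * (1 + \<delta>)"
    unfolding sum_distrib_right by (simp add: w_def mult.commute)
  ultimately have inv: "(\<Sum>j<n. 1 / w j) \<le> real n * (1 + \<omega> * \<delta>)" by simp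
  have w: "w j \<le> \<kappa>" "1 / w j \<le> \<kappa>" if "j < n" for j
    using means_near_one_imp_coordinates_near_one[OF w0 sum inv _ that] \<delta> \<omega> by (auto simp: \<kappa>_def)
  \<comment> \<open>The ratio of the two centroids at \<open>j\<close> is exactly
    \<open>w j * (1 + \<delta>)\<close>, so the bounds on \<open>w j\<close> and its inverse turn
    into the two comparisons.\<close>
  have oj: "centroid h $ j = 1 / w j / (1 + \<delta>) * centroid s $ j"
    and sj: "centroid s $ j = w j * (1 + \<delta>) * centroid h $ j"
    and cs0: "0 < centroid s $ j" and ch0: "0 < centroid h $ j" if "j < n" for j
    using that s0[OF that] h0[OF that] n \<delta> by (auto simp: centroid_index dim w_def)
  have "row A i \<bullet> centroid h \<le> row A i \<bullet> ((\<kappa> / (1 + \<delta>)) \<cdot>\<^sub>v centroid s)"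
  proof (rule scalar_prod_mono)
    fix j assume "j < dim_vec ((\<kappa> / (1 + \<delta>)) \<cdot>\<^sub>v centroid s)"
    then have j: "j < n" by (simp add: dim)
    show "0 \<le> row A i $ j" using A0 j .
    show "centroid h $ j \<le> ((\<kappa> / (1 + \<delta>)) \<cdot>\<^sub>v centroid s) $ j"
      using mult_right_mono[OF divide_right_mono[OF w(2)[OF j]], of "1 + \<delta>" "centroid s $ j"]
        cs0[OF j] \<delta> j
      by (simp add: oj[OF j] dim)
  qed (simp add: dim)
  then show "row A i \<bullet> centroid h \<le> \<kappa> / (1 + \<delta>) * (row A i \<bullet> centroid s)"
    using Ac dim by simp
  have "row A i \<bullet> centroid s \<le> row A i \<bullet> ((\<kappa> * (1 + \<delta>)) \<cdot>\<^sub>v centroid h)"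
  proof (rule scalar_prod_mono)
    fix j assume "j < dim_vec ((\<kappa> * (1 + \<delta>)) \<cdot>\<^sub>v centroid h)"
    then have j: "j < n" by (simp add: dim)
    show "0 \<le> row A i $ j" using A0 j .
    show "centroid s $ j \<le> ((\<kappa> * (1 + \<delta>)) \<cdot>\<^sub>v centroid h) $ j"
      using mult_right_mono[OF mult_right_mono[OF w(1)[OF j]], of "1 + \<delta>" "centroid h $ j"]
        ch0[OF j] \<delta> j
      by (simp add: sj[OF j] dim)
  qed (simp add: dim)
  then show "row A i \<bullet> centroid s \<le> \<kappa> * (1 + \<delta>) * (row A i \<bullet> centroid h)"
    using Ac dim by simp
  let ?M = "Max ((\<lambda>i. 1 / s $ i) ` {..<n})"
  have M: "1 / s $ j \<le> ?M" if "j < n" for j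
    using that by (intro Max_ge) auto
  have M0: "0 \<le> ?M" using M[OF n] s0[OF n] by (smt (verit) zero_less_divide_1_iff)
  have "row A i \<bullet> centroid h = (\<Sum>j<n. A $$ (i, j) * centroid h $ j)"
    using Ac i by (simp add: scalar_prod_def dim lessThan_atLeast0)
  also have "\<dots> \<le> (\<Sum>j<n. ?M * (s $ j * centroid h $ j))"
  proof (rule sum_mono)
    fix j assume "j \<in> {..<n}"
    then have j: "j < n" by simp
    have "A $$ (i, j) \<le> ?M * s $ j"
      using packing_entry_le_1[OF A i j] M[OF j] s0[OF j] by (simp add: divide_le_eq)
    then show "A $$ (i, j) * centroid h $ j \<le> ?M * (s $ j * centroid h $ j)"
      using ch0[OF j] by (metis mult.assoc mult_right_mono less_imp_le)
  qed
  also have "\<dots> = ?M * (s \<bullet> centroid h)"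
    by (simp add: scalar_prod_def dim lessThan_atLeast0 sum_distrib_left)
  also have "\<dots> \<le> ?M * ((1 + \<omega> * \<delta>) / (1 + \<delta>))"
    using sh M0 by (rule mult_left_mono)
  finally show "row A i \<bullet> centroid h \<le> (1 + \<omega> * \<delta>) / (1 + \<delta>) * ?M"
    by (simp add: mult.commute)
qed

text \<open>For \<open>k = 1 + v + v^2\<close>, \<open>(1 - v) * k = 1 - v^3 \<le> 1\<close>, hence
  \<open>p \<ge> 1 / k^2 \<ge> (1 - v)^2 \<ge> 1 - 2 * v\<close>. The bound on \<open>3 * v\<close>
  keeps \<open>1 - v\<close> nonnegative, so squaring preserves the order.\<close>

lemma inverse_square_lower_bound:
  fixes v :: real
  assumes "0 \<le> v" "3 * v \<le> 1" "1 \<le> (1 + v + v\<^sup>2) * ((1 + v + v\<^sup>2) * p)"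
  shows "1 - 3 * v \<le> p"
proof -
  let ?k = "1 + v + v\<^sup>2"
  have k: "0 < ?k * ?k" using assms(1) by (intro mult_pos_pos) (auto intro: add_pos_nonneg)
  have "(1 - v) * ?k \<le> 1"
    using assms(1) by (simp add: algebra_simps power2_eq_square)
  moreover have "0 \<le> (1 - v) * ?k" using assms by (intro mult_nonneg_nonneg) auto
  ultimately have "((1 - v) * ?k) * ((1 - v) * ?k) \<le> 1 * 1" by (intro mult_mono) auto
  then have "(?k * ?k) * ((1 - v) * (1 - v)) \<le> (?k * ?k) * p"
    using assms(3) by (simp add: mult_ac)
  then have "(1 - v) * (1 - v) \<le> p"
    using k mult_le_cancel_left_pos by blast
  moreover have "1 - 3 * v \<le> (1 - v) * (1 - v)"
    using assms(1) by (simp add: algebra_simps)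
  ultimately show ?thesis by linarith
qed

section \<open>Bisection: interval length, termination and cost\<close>

text \<open>The ratios of \<open>h \<mu>\<close> to \<open>s\<close> are affine in
  \<open>\<mu>\<close> with slope \<open>q $ j / s $ j - 1 \<ge> -1\<close>, so each drops by at
  most \<open>hi - lo\<close>. On a shorter interval \<open>sum_inverse_perturbation\<close> with
  \<open>e = T - 1\<close> would keep \<open>h hi\<close> positive and its value below
  \<open>T\<close>.\<close>

lemma bisection_interval_length:
  assumes dim: "s \<in> carrier_vec n" "q \<in> carrier_vec n" and n: "0 < n"
    and s: "pos_vec s" and q: "\<And>j. j < n \<Longrightarrow> 0 \<le> q $ j"
    and lo: "0 \<le> lo" "lo < hi" "hi \<le> 1"
    and T: "T \<le> 2"
  defines "h \<equiv> \<lambda>\<mu>. (1 - \<mu>) \<cdot>\<^sub>v s + \<mu> \<cdot>\<^sub>v q"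
    \<comment> \<open>The first alternative of \<open>right\<close> covers \<open>hi = 1\<close> when \<open>q\<close> has a zero coordinate.\<close>
  assumes left: "s \<bullet> centroid (h lo) \<le> 1"
    and right: "\<not> pos_vec (h hi) \<or> T \<le> s \<bullet> centroid (h hi)"
  shows "(T - 1) / (4 * real n) \<le> hi - lo"
proof (rule ccontr)
  assume "\<not> ?thesis"
  then have short: "4 * real n * (hi - lo) < T - 1" using n by (simp add: field_simps)
  have dh: "dim_vec (h \<mu>) = n" for \<mu> using dim by (simp add: h_def)
  have s0: "0 < s $ j" if "j < n" for j using s dim that by (auto simp: pos_vec_def)
  have hj: "h \<mu> $ j = (1 - \<mu>) * s $ j + \<mu> * q $ j" if "j < n" for \<mu> j
    using that dim by (simp add: h_def)
  define x where "x \<mu> j = h \<mu> $ j / s $ j" for \<mu> j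
  have fx: "(\<Sum>j<n. 1 / x \<mu> j) = real n * (s \<bullet> centroid (h \<mu>))" for \<mu>
    using n by (simp add: x_def scalar_prod_centroid dh)
  \<comment> \<open>Since \<open>lo < hi \<le> 1\<close>, the vector \<open>s\<close> keeps a
    positive weight.\<close>
  have "0 < x lo j" if "j < n" for j
    using lo q[OF that] s0[OF that]
    by (auto simp: x_def hj[OF that] intro!: divide_pos_pos add_pos_nonneg)
  moreover have "(\<Sum>j<n. 1 / x lo j) \<le> real n"
    using left by (simp add: fx mult_left_le)
  moreover have "x lo j - (hi - lo) \<le> x hi j" if "j < n" for j
  proof -
    have "x hi j - (x lo j - (hi - lo)) = (hi - lo) * (q $ j / s $ j)"
      using s0[OF that] by (simp add: x_def hj[OF that] field_simps)
    also have "\<dots> \<ge> 0" using lo q[OF that] s0[OF that] by simp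
    finally show ?thesis by simp
  qed
  ultimately have pos: "\<forall>j<n. 0 < x hi j"
    and lt: "(\<Sum>j<n. 1 / x hi j) < real n * (1 + (T - 1))"
    using sum_inverse_perturbation[of n "x lo" "hi - lo" "x hi" "T - 1"] short lo T n by auto
  have "pos_vec (h hi)"
    using pos s0 by (auto simp: pos_vec_def dh x_def zero_less_divide_iff dest: less_asym)
  moreover have "s \<bullet> centroid (h hi) < T" using lt n by (simp add: fx)
  ultimately show False using right by auto
qed

text \<open>One pass spends 2 operations on the midpoint, \<open>1 + 3 * n\<close> on the mixture,
  \<open>2 * n\<close> each on centroid and scalar product, and one or two on comparisons. The dummy
  computation of type \<open>unit\<close> charges this cost in front of the recursive call.\<close>

lemma bisect_c_step:
  fixes lo hi :: real
  assumes "s \<in> carrier_vec n" "q \<in> carrier_vec n"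
  defines "\<mu> \<equiv> (lo + hi) / 2"
  defines "p \<equiv> centroid ((1 - \<mu>) \<cdot>\<^sub>v s + \<mu> \<cdot>\<^sub>v q)"
  shows "bisect_c s q T lo hi =
    (if s \<bullet> p \<le> 1 then cbind (Some ((), 7 * n + 4)) (\<lambda>_. bisect_c s q T \<mu> hi)
     else if T \<le> s \<bullet> p then cbind (Some ((), 7 * n + 5)) (\<lambda>_. bisect_c s q T lo \<mu>)
     else Some ((\<mu>, p), 7 * n + 5))"
  using assms(1,2)
  by (subst bisect_c.simps)
    (auto simp: primitive_c_defs mix_c_eq centroid_c_eq dot_c_eq \<mu>_def p_def carrier_vecD
      split: option.splits)

text \<open>Either recursive call preserves the conditions at both ends and halves the interval, so
  \<open>N\<close> bounds the number of passes.\<close>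

lemma bisect_c_terminates:
  assumes dim: "s \<in> carrier_vec n" "q \<in> carrier_vec n" and n: "0 < n"
    and s: "pos_vec s" and q: "\<And>j. j < n \<Longrightarrow> 0 \<le> q $ j"
    and T: "T \<le> 2"
  defines "h \<equiv> \<lambda>\<mu>. (1 - \<mu>) \<cdot>\<^sub>v s + \<mu> \<cdot>\<^sub>v q"
  assumes "0 \<le> lo" "lo < hi" "hi \<le> 1"
    and "s \<bullet> centroid (h lo) \<le> 1" "\<not> pos_vec (h hi) \<or> T \<le> s \<bullet> centroid (h hi)"
    and "hi - lo < 2 ^ N * ((T - 1) / (4 * real n))"
  shows "\<exists>\<mu> t. bisect_c s q T lo hi = Some ((\<mu>, centroid (h \<mu>)), t) \<and> t \<le> N * (7 * n + 5) \<and>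
    0 < \<mu> \<and> \<mu> < 1 \<and> 1 < s \<bullet> centroid (h \<mu>) \<and> s \<bullet> centroid (h \<mu>) < T"
  using assms(8-)
proof (induction N arbitrary: lo hi)
  \<comment> \<open>Impossible: the interval would be shorter than
    \<open>bisection_interval_length\<close> permits.\<close>
  case 0
  then show ?case
    using bisection_interval_length[OF dim n s q _ _ _ T, of lo hi] by (simp add: h_def)
next
  case (Suc N)
  define \<mu> where "\<mu> = (lo + hi) / 2"
  have mid: "lo < \<mu>" "\<mu> < hi" using Suc.prems by (auto simp: \<mu>_def)
  define \<eta> where "\<eta> = 2 ^ N * ((T - 1) / (4 * real n))"
  have "hi - lo < 2 * \<eta>" using Suc.prems(6) by (simp add: \<eta>_def)
  then have half: "hi - \<mu> < 2 ^ N * ((T - 1) / (4 * real n))"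
      "\<mu> - lo < 2 ^ N * ((T - 1) / (4 * real n))"
    unfolding \<eta>_def[symmetric] by (simp_all add: \<mu>_def field_simps)
  have step: "bisect_c s q T lo hi =
    (if s \<bullet> centroid (h \<mu>) \<le> 1 then cbind (Some ((), 7 * n + 4)) (\<lambda>_. bisect_c s q T \<mu> hi)
     else if T \<le> s \<bullet> centroid (h \<mu>)
     then cbind (Some ((), 7 * n + 5)) (\<lambda>_. bisect_c s q T lo \<mu>)
     else Some ((\<mu>, centroid (h \<mu>)), 7 * n + 5))"
    unfolding \<mu>_def h_def by (rule bisect_c_step[OF dim])
  consider "s \<bullet> centroid (h \<mu>) \<le> 1" | "1 < s \<bullet> centroid (h \<mu>)" "T \<le> s \<bullet> centroid (h \<mu>)"
    | "1 < s \<bullet> centroid (h \<mu>)" "s \<bullet> centroid (h \<mu>) < T"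
    by linarith
  then show ?case
  proof cases
    case 1
    then show ?thesis
      using Suc.IH[of \<mu> hi] Suc.prems mid half by (auto simp: step)
  next
    case 2
    then show ?thesis
      using Suc.IH[of lo \<mu>] Suc.prems mid half by (auto simp: step)
  next
    case 3
    then show ?thesis
      using Suc.prems mid by (auto simp: step)
  qed
qed

text \<open>The quantity \<open>L\<close> equals \<open>n / (T - 1)\<close>, so the unit interval is
  \<open>4 * L\<close> times the minimal length, and about
  \<open>log 2 (4 * L) = 2 + log 2 L\<close> halvings suffice.\<close>

lemma bisect_c_from_unit_interval:
  assumes dim: "s \<in> carrier_vec n" "q \<in> carrier_vec n" and n: "0 < n"
    and s: "pos_vec s" and q: "\<And>j. j < n \<Longrightarrow> 0 \<le> q $ j"
    and \<delta>: "0 < \<delta>" and \<omega>: "1 < \<omega>" "\<omega> \<le> 2"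
  defines "T \<equiv> (1 + \<omega> * \<delta>) / (1 + \<delta>)"
    and "L \<equiv> real n / ((\<omega> - 1) * \<delta>) + real n / (\<omega> - 1)"
    and "h \<equiv> \<lambda>\<mu>. (1 - \<mu>) \<cdot>\<^sub>v s + \<mu> \<cdot>\<^sub>v q"
  assumes right: "\<not> pos_vec q \<or> T \<le> s \<bullet> centroid q"
  obtains \<mu> t where "bisect_c s q T 0 1 = Some ((\<mu>, centroid (h \<mu>)), t)"
    and "real t \<le> (3 + log 2 L) * (7 * real n + 5)"
    and "0 < \<mu>" "\<mu> < 1" "1 < s \<bullet> centroid (h \<mu>)" "s \<bullet> centroid (h \<mu>) < T"
proof -
  \<comment> \<open>From \<open>L \<ge> 1\<close> the logarithm is nonnegative, so
    \<open>nat\<close> does not truncate in \<open>N\<close> below.\<close>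
  have "1 \<le> real n / (\<omega> - 1)" using n \<omega> by (simp add: field_simps)
  moreover have "0 < real n / ((\<omega> - 1) * \<delta>)" using n \<delta> \<omega> by simp
  ultimately have L: "1 \<le> L" unfolding L_def by linarith
  have T_1: "T - 1 = (\<omega> - 1) * \<delta> / (1 + \<delta>)" using \<delta> by (simp add: T_def field_simps)
  have T: "T \<le> 2"
  proof -
    have "\<omega> * \<delta> \<le> 2 * \<delta>" using \<omega> \<delta> by (intro mult_right_mono) auto
    then have "1 + \<omega> * \<delta> \<le> 2 * (1 + \<delta>)" by (simp add: algebra_simps)
    then show ?thesis using \<delta> by (simp add: T_def divide_le_eq)
  qed
  have L_eq: "L = real n * (1 + \<delta>) / ((\<omega> - 1) * \<delta>)"
    using \<delta> \<omega> by (simp add: L_def divide_simps) (simp add: algebra_simps)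
  have "4 * L * ((T - 1) / (4 * real n)) = 1"
    unfolding T_1 L_eq using \<delta> \<omega> n by simp
  \<comment> \<open>The \<open>+ 1\<close> makes \<open>2 ^ N\<close> strictly larger than
    \<open>4 * L\<close>, as the strict length condition requires.\<close>
  define N where "N = nat \<lfloor>log 2 (4 * L)\<rfloor> + 1"
  have log4: "log 2 (4 * L) = 2 + log 2 L"
    using L log_of_power_eq[of 4 2 2] by (simp add: log_mult)
  have log0: "0 \<le> log 2 L" using L by simp
  have N: "log 2 (4 * L) < real N" "real N \<le> 3 + log 2 L"
    using log4 log0 by (auto simp: N_def of_nat_nat) linarith+
  have "4 * L < 2 ^ N"
    using N(1) L by (simp add: log_less_iff powr_realpow)
  moreover have "0 < (T - 1) / (4 * real n)"
    unfolding T_1 using \<delta> \<omega> n by simp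
  ultimately have "4 * L * ((T - 1) / (4 * real n)) < 2 ^ N * ((T - 1) / (4 * real n))"
    by (rule mult_strict_right_mono)
  then have len: "1 - 0 < 2 ^ N * ((T - 1) / (4 * real n))"
    unfolding \<open>4 * L * ((T - 1) / (4 * real n)) = 1\<close> by (simp only: diff_zero)
  have h0: "(1 - 0) \<cdot>\<^sub>v s + 0 \<cdot>\<^sub>v q = s" and h1: "(1 - 1) \<cdot>\<^sub>v s + 1 \<cdot>\<^sub>v q = q"
    using dim by auto
  have "\<exists>\<mu> t. bisect_c s q T 0 1 = Some ((\<mu>, centroid (h \<mu>)), t) \<and> t \<le> N * (7 * n + 5) \<and>
    0 < \<mu> \<and> \<mu> < 1 \<and> 1 < s \<bullet> centroid (h \<mu>) \<and> s \<bullet> centroid (h \<mu>) < T"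
    unfolding h_def
  proof (rule bisect_c_terminates[OF dim n s q T])
    \<comment> \<open>The left end is \<open>s\<close> itself, where the value is exactly
      \<open>1\<close>.\<close>
    show "s \<bullet> centroid ((1 - 0) \<cdot>\<^sub>v s + 0 \<cdot>\<^sub>v q) \<le> 1"
      using scalar_prod_centroid_self[OF s] dim n unfolding h0 by simp
    show "\<not> pos_vec ((1 - 1) \<cdot>\<^sub>v s + 1 \<cdot>\<^sub>v q) \<or> T \<le> s \<bullet> centroid ((1 - 1) \<cdot>\<^sub>v s + 1 \<cdot>\<^sub>v q)"
      unfolding h1 by (rule right)
  qed (use len in auto)
  then obtain \<mu> t where *: "bisect_c s q T 0 1 = Some ((\<mu>, centroid (h \<mu>)), t)"
    "t \<le> N * (7 * n + 5)" "0 < \<mu>" "\<mu> < 1" "1 < s \<bullet> centroid (h \<mu>)" "s \<bullet> centroid (h \<mu>) < T"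
    by blast
  have "real t \<le> real N * (7 * real n + 5)"
    using of_nat_mono[OF *(2), where ?'a = real] by simp
  also have "\<dots> \<le> (3 + log 2 L) * (7 * real n + 5)"
    using N(2) by (intro mult_right_mono) auto
  finally show thesis using that * by blast
qed

section \<open>The three branches of the oracle\<close>

text \<open>A single weight covers all branches: \<open>\<mu> = 1\<close> when \<open>q\<close> is
  returned, \<open>\<mu> = 0\<close> for \<open>s\<close>, and the bisection result otherwise. The
  geometric bounds are then needed only once, for \<open>h \<mu>\<close>.\<close>

lemma centroid_oracle_correct:
  assumes dim: "s \<in> carrier_vec n" "q \<in> carrier_vec n" and n: "0 < n"
    and s: "pos_vec s" and q: "\<And>j. j < n \<Longrightarrow> 0 \<le> q $ j"
    and \<delta>: "0 < \<delta>" and \<omega>: "1 < \<omega>" "\<omega> \<le> 2"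
  defines "T \<equiv> (1 + \<omega> * \<delta>) / (1 + \<delta>)"
    and "L \<equiv> real n / ((\<omega> - 1) * \<delta>) + real n / (\<omega> - 1)"
    and "h \<equiv> \<lambda>\<mu>. (1 - \<mu>) \<cdot>\<^sub>v s + \<mu> \<cdot>\<^sub>v q"
  assumes l: "ls \<in> carrier_vec m" "lq \<in> carrier_vec m"
  obtains \<mu> t where
    "centroid_oracle s ls q lq \<delta> \<omega> =
      Some (((1 - \<mu>) \<cdot>\<^sub>v ls + \<mu> \<cdot>\<^sub>v lq, centroid (h \<mu>)), t)"
    and "real t \<le> 99 * real n * max 1 (log 2 L)"
    and "0 \<le> \<mu>" "\<mu> \<le> 1" "pos_vec (h \<mu>)"
    and "s \<bullet> centroid (h \<mu>) \<le> T" "q \<bullet> centroid (h \<mu>) \<le> 1"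
proof -
  have h: "h 0 = s" "h 1 = q" using dim by (auto simp: h_def)
  have l01: "ls + 0 \<cdot>\<^sub>v lq = ls" "0 \<cdot>\<^sub>v ls + lq = lq"
    using l by auto
  have T: "1 \<le> T" using \<delta> \<omega> by (simp add: T_def)
  have M: "real n \<le> real n * max 1 (log 2 L)" using n by simp
  have dq: "dim_vec q = n" and ds: "dim_vec s = n" using dim by auto
  obtain tz where tz: "tz \<le> n" "has_zero_c q = Some (\<exists>i<n. q $ i = 0, tz)"
    using has_zero_c_eq[of q] dq by auto
  have zero_iff: "(\<exists>i<n. q $ i = 0) \<longleftrightarrow> \<not> pos_vec q"
    using q dq by (force simp: pos_vec_def less_le)
  \<comment> \<open>Computing \<open>T\<close> takes 4 operations; each of the two tests takes
    \<open>4 * n + 1\<close>, the first only for positive \<open>q\<close>. The zero scan stops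
    comparing after a hit, so \<open>tz\<close> is only bounded.\<close>
  have oracle_eq: "centroid_oracle s ls q lq \<delta> \<omega> =
      (if pos_vec q \<and> s \<bullet> centroid q \<le> T then Some ((lq, centroid q), 5 + tz + 4 * n)
       else cbind (Some ((), 5 + tz + (if pos_vec q then 4 * n + 1 else 0) + 4 * n))
         (\<lambda>_. if q \<bullet> centroid s \<le> 1 then ret (ls, centroid s)
           else cbind (bisect_c s q T 0 1) (\<lambda>(\<mu>, p). ret ((1 - \<mu>) \<cdot>\<^sub>v ls + \<mu> \<cdot>\<^sub>v lq, p))))"
    unfolding centroid_oracle_def
    by (simp add: primitive_c_defs centroid_c_eq dot_c_eq tz(2) zero_iff dq ds
        flip: T_def split: option.splits)
  consider "pos_vec q" "s \<bullet> centroid q \<le> T"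
    | "\<not> (pos_vec q \<and> s \<bullet> centroid q \<le> T)" "q \<bullet> centroid s \<le> 1"
    | "\<not> (pos_vec q \<and> s \<bullet> centroid q \<le> T)" "\<not> q \<bullet> centroid s \<le> 1"
    by blast
  then show thesis
  proof cases
    case 1
    have "real (5 + tz + 4 * n) \<le> 99 * real n" using tz(1) n by simp
    then show thesis
      using that[of 1 "5 + tz + 4 * n"] 1 M scalar_prod_centroid_self[OF 1(1)] n dq
      by (simp add: oracle_eq h l01)
  next
    case 2
    define t where "t = 5 + tz + (if pos_vec q then 4 * n + 1 else 0) + 4 * n"
    have "real t \<le> 99 * real n" using tz(1) n by (simp add: t_def)
    then show thesis
      using that[of 0 t] 2 M T scalar_prod_centroid_self[OF s] n ds s
      by (auto simp: oracle_eq h l01 ret_def t_def)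
  next
    case 3
    then have "\<not> pos_vec q \<or> T \<le> s \<bullet> centroid q" by auto
    then obtain \<mu> t where b: "bisect_c s q T 0 1 = Some ((\<mu>, centroid (h \<mu>)), t)"
        "real t \<le> (3 + log 2 L) * (7 * real n + 5)"
        "0 < \<mu>" "\<mu> < 1" "1 < s \<bullet> centroid (h \<mu>)" "s \<bullet> centroid (h \<mu>) < T"
      using bisect_c_from_unit_interval[OF dim n s q \<delta> \<omega>] unfolding T_def L_def h_def by blast
    define t' where "t' = 5 + tz + (if pos_vec q then 4 * n + 1 else 0) + 4 * n + t"
    have "centroid_oracle s ls q lq \<delta> \<omega> =
        Some (((1 - \<mu>) \<cdot>\<^sub>v ls + \<mu> \<cdot>\<^sub>v lq, centroid (h \<mu>)), t')"
      using 3 by (auto simp: oracle_eq b(1) ret_def t'_def)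
    moreover have "real t' \<le> 99 * real n * max 1 (log 2 L)"
    proof -
      \<comment> \<open>As \<open>X\<close> and \<open>n\<close> are at least \<open>1\<close>, they
        absorb the additive constants; the total factor is \<open>15 + 48 = 63\<close>, within
        \<open>99\<close>.\<close>
      define X where "X = max 1 (log 2 L)"
      note b(2)
      also have "(3 + log 2 L) * (7 * real n + 5) \<le> (4 * X) * (12 * real n)"
        using n by (intro mult_mono) (auto simp: X_def)
      finally have "real t \<le> 48 * (real n * X)" by (simp add: mult.commute)
      moreover have "real t' \<le> 15 * real n + real t" using tz(1) n by (simp add: t'_def)
      moreover have "real n \<le> real n * X" "0 \<le> real n * X"
        using M by (auto simp: X_def)
      ultimately have "real t' \<le> 99 * (real n * X)" by linarith
      then show ?thesis by (simp add: X_def mult.assoc)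
    qed
    moreover have "pos_vec (h \<mu>)"
      using s q b(3,4) dq ds
      by (auto simp: pos_vec_def h_def intro!: add_pos_nonneg)
    \<comment> \<open>The values at \<open>s\<close> and \<open>q\<close> have weighted mean
      \<open>h \<mu> \<bullet> centroid (h \<mu>) = 1\<close>. Bisection ensures that the first
      exceeds \<open>1\<close>, so the second cannot.\<close>
    moreover have "q \<bullet> centroid (h \<mu>) \<le> 1"
    proof (rule ccontr)
      assume "\<not> ?thesis"
      then have "1 < q \<bullet> centroid (h \<mu>)" by simp
      then have "(1 - \<mu>) * 1 + \<mu> * 1
          < (1 - \<mu>) * (s \<bullet> centroid (h \<mu>)) + \<mu> * (q \<bullet> centroid (h \<mu>))"
        using b(3-5) by (intro add_strict_mono mult_strict_left_mono) auto
      also have "\<dots> = h \<mu> \<bullet> centroid (h \<mu>)"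
      proof -
        have "centroid (h \<mu>) \<in> carrier_vec n" using dim by (auto simp: h_def intro: carrier_vecI)
        then show ?thesis using dim by (simp add: h_def add_scalar_prod_distrib[of _ n])
      qed
      also have "\<dots> = 1"
        using scalar_prod_centroid_self[OF \<open>pos_vec (h \<mu>)\<close>] n dq by (simp add: h_def)
      finally show False by simp
    qed
    ultimately show thesis using that b by (meson less_imp_le)
  qed
qed

section \<open>Assembling the oracle guarantees\<close>

text \<open>\<open>C\<close> is chosen before all data, so the running time bound is uniform. The
  \<open>max 1\<close> covers arguments close to \<open>1\<close>, where the logarithm is near
  \<open>0\<close> but work of order \<open>n\<close> remains.\<close>

theorem proposition18:
  "\<exists>C::real. \<forall>(m::nat) (n::nat) (A::real mat) (s::real vec) (ls::real vec) (q::real vec) (lq::real vec)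
      (\<delta>::real) (\<omega>::real).
     packing_matrix m n A \<longrightarrow>
     ls \<in> simplex m \<longrightarrow> s = A\<^sup>T *\<^sub>v ls \<longrightarrow>
     0 < \<delta> \<longrightarrow> pos_vec s \<longrightarrow> g_hat A (centroid s) \<le> 1 + \<delta> \<longrightarrow>
     lq \<in> simplex m \<longrightarrow> q = A\<^sup>T *\<^sub>v lq \<longrightarrow>
     1 < \<omega> \<longrightarrow> \<omega> \<le> 2 \<longrightarrow>
     (let U = ((1 + \<omega> * \<delta> * real n + sqrt (\<omega> * \<delta> * real n)) / (1 + \<delta>)) \<cdot>\<^sub>v centroid s;
          I = {i. i < m \<and> row A i \<bullet> U \<ge> 1};
          \<sigma> = min (sqrt (\<omega> * \<delta> * real n) + \<omega> * \<delta> * real n)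
                  ((1 + \<omega> * \<delta>) / (1 + \<delta>) * Max ((\<lambda>i. 1 / s $ i) ` {..<n}) - 1);
          \<tau> = min (3 * sqrt (\<omega> * \<delta> * real n)) 1
      in \<exists>lo ov t.
           centroid_oracle s ls q lq \<delta> \<omega> = Some ((lo, ov), t) \<and>
           lo \<in> simplex m \<and>
           ov \<in> centroid_set (row_hull A) \<and>
           pos_vec (A\<^sup>T *\<^sub>v lo) \<and> ov = centroid (A\<^sup>T *\<^sub>v lo) \<and>
           q \<bullet> ov \<le> 1 \<and>
           (\<forall>i\<in>I. row A i \<bullet> ov \<in> {1 - \<tau> .. 1 + \<sigma>}) \<and>
           (\<forall>i\<in>{..<m} - I. row A i \<bullet> ov \<le> 1) \<and>
           real t \<le> C * real n *
             max 1 (log 2 (real n / ((\<omega> - 1) * \<delta>) + real n / (\<omega> - 1))))"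
proof (rule exI[of _ 99], intro allI impI, unfold Let_def)
  fix m n :: nat and A :: "real mat" and s ls q lq :: "real vec" and \<delta> \<omega> :: real
  assume A: "packing_matrix m n A"
    and ls: "ls \<in> simplex m" and s: "s = A\<^sup>T *\<^sub>v ls" and \<delta>: "0 < \<delta>" and s_pos: "pos_vec s"
    and g: "g_hat A (centroid s) \<le> 1 + \<delta>"
    and lq: "lq \<in> simplex m" and q: "q = A\<^sup>T *\<^sub>v lq" and \<omega>: "1 < \<omega>" "\<omega> \<le> 2"
  let ?v = "sqrt (\<omega> * \<delta> * real n)"
  let ?\<kappa> = "1 + \<omega> * \<delta> * real n + ?v"
  let ?U = "(?\<kappa> / (1 + \<delta>)) \<cdot>\<^sub>v centroid s"
  let ?I = "{i. i < m \<and> row A i \<bullet> ?U \<ge> 1}"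
  let ?M = "(1 + \<omega> * \<delta>) / (1 + \<delta>) * Max ((\<lambda>i. 1 / s $ i) ` {..<n})"
  let ?L = "real n / ((\<omega> - 1) * \<delta>) + real n / (\<omega> - 1)"
  have Ac: "A \<in> carrier_mat m n" and n: "0 < n" using A by (auto simp: packing_matrix_def)
  have dim: "s \<in> carrier_vec n" "q \<in> carrier_vec n" using Ac ls lq by (auto simp: s q simplex_def)
  have q0: "\<And>j. j < n \<Longrightarrow> 0 \<le> q $ j" unfolding q using row_hull_nonneg[OF A lq] .
  have lc: "ls \<in> carrier_vec m" "lq \<in> carrier_vec m" using ls lq by (auto simp: simplex_def)
  have g': "\<forall>i<m. row A i \<bullet> centroid s \<le> 1 + \<delta>"
  proof (intro allI impI)
    fix i assume "i < m"
    have "row A i \<bullet> centroid s \<le> g_hat A (centroid s)"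
      unfolding g_hat_def using \<open>i < m\<close> Ac by (intro Max_ge) auto
    then show "row A i \<bullet> centroid s \<le> 1 + \<delta>" using g by simp
  qed
  obtain \<mu> t where o: "centroid_oracle s ls q lq \<delta> \<omega> =
      Some (((1 - \<mu>) \<cdot>\<^sub>v ls + \<mu> \<cdot>\<^sub>v lq, centroid ((1 - \<mu>) \<cdot>\<^sub>v s + \<mu> \<cdot>\<^sub>v q)), t)"
    and t: "real t \<le> 99 * real n * max 1 (log 2 ?L)"
    and \<mu>: "0 \<le> \<mu>" "\<mu> \<le> 1" and h_pos: "pos_vec ((1 - \<mu>) \<cdot>\<^sub>v s + \<mu> \<cdot>\<^sub>v q)"
    and sh: "s \<bullet> centroid ((1 - \<mu>) \<cdot>\<^sub>v s + \<mu> \<cdot>\<^sub>v q) \<le> (1 + \<omega> * \<delta>) / (1 + \<delta>)"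
    and qh: "q \<bullet> centroid ((1 - \<mu>) \<cdot>\<^sub>v s + \<mu> \<cdot>\<^sub>v q) \<le> 1"
    using centroid_oracle_correct[OF dim n s_pos q0 \<delta> \<omega> lc] by blast
  define lo where "lo = (1 - \<mu>) \<cdot>\<^sub>v ls + \<mu> \<cdot>\<^sub>v lq"
  define h where "h = (1 - \<mu>) \<cdot>\<^sub>v s + \<mu> \<cdot>\<^sub>v q"
  note defs = lo_def[symmetric] h_def[symmetric]
  have lo: "lo \<in> simplex m" unfolding lo_def by (rule simplex_convex[OF ls lq \<mu>])
  have h: "h = A\<^sup>T *\<^sub>v lo"
    unfolding lo_def h_def s q using Ac lc
    by (simp add: mult_add_distrib_mat_vec[of _ n m] mult_mat_vec[of _ n m])
  note b = centroid_bounds[OF A dim(1) s_pos g' lo h h_pos[unfolded defs] \<delta> \<omega>(1) sh[unfolded defs]]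
  have \<kappa>: "1 + ?v + \<omega> * \<delta> * real n = ?\<kappa>" by simp
  have U: "row A i \<bullet> ?U = ?\<kappa> / (1 + \<delta>) * (row A i \<bullet> centroid s)" if "i < m" for i
    using that Ac dim by simp
  have v2: "?v\<^sup>2 = \<omega> * \<delta> * real n" using \<delta> \<omega> by simp
  have \<kappa>0: "0 < ?\<kappa>" using \<delta> \<omega> by (auto intro!: add_pos_nonneg)
  \<comment> \<open>The first bound together with \<open>g'\<close> gives \<open>?\<kappa>\<close>;
    the third gives \<open>?M\<close>.\<close>
  have upper: "row A i \<bullet> centroid h \<le> 1 + min (?v + \<omega> * \<delta> * real n) (?M - 1)" if i: "i < m" for i
  proof -
    have "?\<kappa> / (1 + \<delta>) * (row A i \<bullet> centroid s) \<le> ?\<kappa> / (1 + \<delta>) * (1 + \<delta>)"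
      using g' i \<kappa>0 \<delta> by (intro mult_left_mono) auto
    then show ?thesis using b(1,3)[OF i] \<delta> by (simp add: \<kappa>)
  qed
  \<comment> \<open>Membership in \<open>?I\<close> and the second bound combine, the factors
    \<open>1 + \<delta>\<close> cancelling, to \<open>1 \<le> ?\<kappa>^2 * ?p\<close>. If
    \<open>3 * ?v > 1\<close>, the claim is only \<open>?p \<ge> 0\<close>.\<close>
  have lower: "1 - min (3 * ?v) 1 \<le> row A i \<bullet> centroid h" if i: "i \<in> ?I" for i
  proof -
    let ?p = "row A i \<bullet> centroid h"
    have im: "i < m" using i by simp
    have "1 \<le> ?\<kappa> / (1 + \<delta>) * (row A i \<bullet> centroid s)" using i U by auto
    also have "\<dots> \<le> ?\<kappa> / (1 + \<delta>) * (?\<kappa> * (1 + \<delta>) * ?p)"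
      using b(2)[OF im] \<kappa>0 \<delta> by (intro mult_left_mono) (auto simp: \<kappa>)
    also have "\<dots> = (1 + ?v + ?v\<^sup>2) * ((1 + ?v + ?v\<^sup>2) * ?p)"
      using \<delta> by (simp add: v2 \<kappa>)
    finally have *: "1 \<le> (1 + ?v + ?v\<^sup>2) * ((1 + ?v + ?v\<^sup>2) * ?p)" .
    moreover have "0 \<le> ?v" using \<delta> \<omega> by simp
    ultimately have "3 * ?v \<le> 1 \<Longrightarrow> 1 - 3 * ?v \<le> ?p"
      by (intro inverse_square_lower_bound)
    moreover have "0 \<le> ?p"
      using * \<kappa>0 unfolding v2 \<kappa> by (smt (verit) mult_nonneg_nonpos mult_nonneg_nonneg)
    ultimately show ?thesis by (auto simp: min_def)
  qed
  \<comment> \<open>The first bound says that the value at \<open>centroid h\<close> is at most that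
    at \<open>?U\<close>, which is below \<open>1\<close> off \<open>?I\<close>.\<close>
  have outside: "row A i \<bullet> centroid h \<le> 1" if "i \<in> {..<m} - ?I" for i
    using that b(1)[of i] U[of i] by (auto simp: \<kappa>)
  have "centroid h \<in> centroid_set (row_hull A)"
    using lo h h_pos Ac unfolding centroid_set_def row_hull_def defs by blast
  moreover have "\<forall>i\<in>?I. row A i \<bullet> centroid h
      \<in> {1 - min (3 * ?v) 1 .. 1 + min (?v + \<omega> * \<delta> * real n) (?M - 1)}"
    using upper lower by (metis (mono_tags, lifting) atLeastAtMost_iff mem_Collect_eq)
  ultimately show "\<exists>lo ov t.
      centroid_oracle s ls q lq \<delta> \<omega> = Some ((lo, ov), t) \<and>
      lo \<in> simplex m \<and>
      ov \<in> centroid_set (row_hull A) \<and>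
      pos_vec (A\<^sup>T *\<^sub>v lo) \<and> ov = centroid (A\<^sup>T *\<^sub>v lo) \<and>
      q \<bullet> ov \<le> 1 \<and>
      (\<forall>i\<in>?I. row A i \<bullet> ov \<in> {1 - min (3 * ?v) 1 .. 1 + min (?v + \<omega> * \<delta> * real n) (?M - 1)}) \<and>
      (\<forall>i\<in>{..<m} - ?I. row A i \<bullet> ov \<le> 1) \<and>
      real t \<le> 99 * real n * max 1 (log 2 ?L)"
    using o t lo qh h_pos outside unfolding defs
    by (intro exI[of _ lo] exI[of _ "centroid h"] exI[of _ t], fold h, intro conjI)
      (assumption | rule refl | blast)+
qed

end
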